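(* Let $w$ be a word on the alphabet $[n]=\{1,\dots,n\}$ and let $\sigma$ be a separable permutation. If $w$ contains $\sigma$ as a pattern, then $\mathrm{sh}(w)\supseteq \mathrm{sh}(\sigma)$ (containment of Ferrers diagrams, i.e. $\mathrm{sh}(w)_i\ge \mathrm{sh}(\sigma)_i$ for all $i$).
   Context: A word is a finite sequence of positive integers; permutations are written in one-line notation. A word $w=w(1)\cdots w(a)$ contains the pattern $\pi\in S_m$ ($m\le a$) if there are indices $1\le i_1<\dots<i_m\le a$ such that for all $j,k$: $w(i_j)<w(i_k)$ iff $\pi(j)<\pi(k)$, and $w(i_j)>w(i_k)$ iff $\pi(j)>\pi(k)$. A permutation is separable if it contains neither of the patterns $3142$ and $2413$. The shape $\mathrm{sh}(w)$ of a word $w$ is the (partition) shape of the insertion tableau obtained from $w$ by the Robinson–Schensted–Knuth correspondence (row insertion, where an inserted entry $x$ bumps the leftmost entry of the row strictly greater than $x$, or is placed at the end of the row if no such entry exists); partitions are written with weakly decreasing parts, padded with zeros. *)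

theory Defs
  imports "HOL-Combinatorics.Multiset_Permutations"
begin

(* Words are lists of naturals.  A permutation in S_m, in one-line notation, is an element of
   permutations_of_set {1..m}: its entries are 1, ..., m, while list positions start at 0. *)

definition contains_pattern :: "nat list \<Rightarrow> nat list \<Rightarrow> bool" where
  "contains_pattern w p \<longleftrightarrow>
     (\<exists>i :: nat \<Rightarrow> nat.
        strict_mono_on {..<length p} i \<and>
        (\<forall>j < length p. i j < length w) \<and>
        (\<forall>j < length p. \<forall>k < length p.
           (w ! i j < w ! i k \<longleftrightarrow> p ! j < p ! k) \<and>
           (w ! i j > w ! i k \<longleftrightarrow> p ! j > p ! k)))"

definition separable :: "nat list \<Rightarrow> bool" where
  "separable p \<longleftrightarrow>
     \<not> contains_pattern p [3, 1, 4, 2] \<and> \<not> contains_pattern p [2, 4, 1, 3]"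

(* The second component is the entry bumped out of the row, if there is one. *)
fun row_insert :: "nat \<Rightarrow> nat list \<Rightarrow> nat list \<times> nat option" where
  "row_insert x [] = ([x], None)"
| "row_insert x (y # ys) =
     (if x < y then (x # ys, Some y)
      else (case row_insert x ys of (zs, b) \<Rightarrow> (y # zs, b)))"

(* A tableau is the list of its rows, top row first (English convention). *)
fun tableau_insert :: "nat \<Rightarrow> nat list list \<Rightarrow> nat list list" where
  "tableau_insert x [] = [[x]]"
| "tableau_insert x (r # rs) =
     (case row_insert x r of
        (r', None) \<Rightarrow> r' # rs
      | (r', Some y) \<Rightarrow> r' # tableau_insert y rs)"

definition insertion_tableau :: "nat list \<Rightarrow> nat list list" where
  "insertion_tableau w = fold tableau_insert w []"

(* sh w i is the part of index i + 1 of the shape in the usual 1-based numbering of parts. *)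
definition sh :: "nat list \<Rightarrow> nat \<Rightarrow> nat" where
  "sh w i = (let P = insertion_tableau w in if i < length P then length (P ! i) else 0)"

end

theory Submission
  imports Defs "HOL-Library.Sublist"
begin

text \<open>By Greene's theorem, the first \<open>k\<close> parts of the shape sum to the largest number of positions covered by
  \<open>k\<close> disjoint weakly increasing subsequences (chains). A separable permutation \<open>\<sigma>\<close> is built from single
  entries by direct and skew sums, and along this construction one finds numbers \<open>\<mu> 0 \<ge> \<mu> 1 \<ge> \<dots>\<close> of total at
  least the length of \<open>\<sigma>\<close> such that removing any \<open>k\<close> chains from \<open>\<sigma>\<close> leaves an increasing
  subsequence of length \<open>\<mu> k\<close>. Hence an optimal family of \<open>k\<close> chains in a word containing \<open>\<sigma>\<close>
  can be enlarged by a chain with \<open>\<mu> k\<close> entries, so part \<open>k\<close> of the shape of the word is at least \<open>\<mu> k\<close>.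
  Applied to \<open>\<sigma>\<close> itself, whose parts sum to its length, this forces \<open>\<mu>\<close> to be the shape of \<open>\<sigma>\<close>.\<close>

subsection \<open>Coloured words\<close>

text \<open>A family of disjoint chains is a colouring of the positions of the word, one colour of \<open>C\<close> per chain;
  positions whose colour lies outside \<open>C\<close> are in no chain.\<close>

definition col :: "'c \<Rightarrow> ('a \<times> 'c) list \<Rightarrow> 'a list" where
  "col c ps = map fst (filter (\<lambda>p. snd p = c) ps)"

definition rising :: "'c set \<Rightarrow> ('a::linorder \<times> 'c) list \<Rightarrow> bool" where
  "rising C ps \<longleftrightarrow> (\<forall>c\<in>C. sorted (col c ps))"

definition covered :: "'c set \<Rightarrow> ('a \<times> 'c) list \<Rightarrow> nat" where
  "covered C ps = length (filter (\<lambda>p. snd p \<in> C) ps)"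

lemma col_simps [simp]:
  "col c [] = []"
  "col c ((x, d) # ps) = (if d = c then x # col c ps else col c ps)"
  "col c (ps @ qs) = col c ps @ col c qs"
  by (simp_all add: col_def)

lemma covered_simps [simp]:
  "covered C [] = 0"
  "covered C ((x, d) # ps) = (if d \<in> C then Suc (covered C ps) else covered C ps)"
  "covered C (ps @ qs) = covered C ps + covered C qs"
  by (simp_all add: covered_def)

lemma in_set_col: "x \<in> set (col c ps) \<longleftrightarrow> (x, c) \<in> set ps"
  by (force simp: col_def)

text \<open>Recolouring only the part of a word behind a Knuth move lets two chains exchange their
  tails.\<close>

definition swap_colours :: "'c \<Rightarrow> 'c \<Rightarrow> ('a \<times> 'c) list \<Rightarrow> ('a \<times> 'c) list" where
  "swap_colours c d = map (apsnd (Transposition.transpose c d))"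

lemma map_fst_swap_colours [simp]: "map fst (swap_colours c d ps) = map fst ps"
  by (simp add: swap_colours_def)

lemma col_swap_colours [simp]:
  "col e (swap_colours c d ps) = col (Transposition.transpose c d e) ps"
proof (induction ps)
  case (Cons p ps)
  have "Transposition.transpose c d x = e \<longleftrightarrow> x = Transposition.transpose c d e" for x
    by (auto simp: Transposition.transpose_def)
  with Cons show ?case
    by (cases p) (auto simp: swap_colours_def)
qed (simp add: swap_colours_def)

lemma covered_swap_colours [simp]:
  assumes "c \<in> C" "d \<in> C"
  shows "covered C (swap_colours c d ps) = covered C ps"
proof (induction ps)
  case (Cons p ps)
  have "Transposition.transpose c d x \<in> C \<longleftrightarrow> x \<in> C" for x
    using assms by (auto simp: Transposition.transpose_def)
  with Cons show ?case
    by (cases p) (auto simp: swap_colours_def)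
qed (simp add: swap_colours_def)

subsection \<open>Knuth relations\<close>

text \<open>Knuth (plactic) equivalence, with the weak and strict inequalities fitting words with
  repeated letters. A rule is named after the order of its three letters before the move; each of
  the two relations appears in both directions.\<close>

inductive knuth :: "'a::linorder list \<Rightarrow> 'a list \<Rightarrow> bool" where
  knuth_refl: "knuth w w"
| knuth_trans: "knuth u v \<Longrightarrow> knuth v w \<Longrightarrow> knuth u w"
| yxz: "x < y \<Longrightarrow> y \<le> z \<Longrightarrow> knuth (u @ [y, x, z] @ v) (u @ [y, z, x] @ v)"
| yzx: "x < y \<Longrightarrow> y \<le> z \<Longrightarrow> knuth (u @ [y, z, x] @ v) (u @ [y, x, z] @ v)"
| xzy: "x \<le> y \<Longrightarrow> y < z \<Longrightarrow> knuth (u @ [x, z, y] @ v) (u @ [z, x, y] @ v)"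
| zxy: "x \<le> y \<Longrightarrow> y < z \<Longrightarrow> knuth (u @ [z, x, y] @ v) (u @ [x, z, y] @ v)"

lemma knuth_sym: "knuth u v \<Longrightarrow> knuth v u"
proof (induction rule: knuth.induct)
  case (knuth_trans u v w)
  then show ?case by (blast intro: knuth.knuth_trans)
qed (rule knuth.knuth_refl knuth.yxz knuth.yzx knuth.xzy knuth.zxy; assumption)+

lemma knuth_context: "knuth u v \<Longrightarrow> knuth (a @ u @ b) (a @ v @ b)"
proof (induction rule: knuth.induct)
  case (yxz x y z u v)
  then show ?case using knuth.yxz[of x y z "a @ u" "v @ b"] by simp
next
  case (yzx x y z u v)
  then show ?case using knuth.yzx[of x y z "a @ u" "v @ b"] by simp
next
  case (xzy x y z u v)
  then show ?case using knuth.xzy[of x y z "a @ u" "v @ b"] by simp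
next
  case (zxy x y z u v)
  then show ?case using knuth.zxy[of x y z "a @ u" "v @ b"] by simp
qed (auto intro: knuth.intros)

text \<open>Only the relative order inside a single colour of \<open>C\<close> matters.\<close>

lemma rising_swap_adjacent:
  assumes "rising C (u @ [p, q] @ v)" "snd p = snd q \<Longrightarrow> snd p \<notin> C"
  shows "rising C (u @ [q, p] @ v)"
  using assms by (cases p; cases q) (auto simp: rising_def)

lemma rising_adjacent_le:
  assumes "rising C (u @ [(x, c), (y, c)] @ v)" "c \<in> C"
  shows "x \<le> y"
  using assms by (auto simp: rising_def sorted_append)

text \<open>If a Knuth move separates two consecutive entries of a chain, its middle letter \<open>y\<close> takes over the role of
  one of them; when \<open>y\<close> lies on another chain, the two chains exchange their tails.\<close>

lemma exchange_xzy:
  assumes ch: "rising C (u @ [(x, c), (z, c), (y, d)] @ v)" and c: "c \<in> C" and "x \<le> y" "y < z"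
  shows "\<exists>v'. rising C (u @ [(z, d), (x, c), (y, c)] @ v') \<and> map fst v' = map fst v
    \<and> covered C v' = covered C v"
proof -
  have S: "sorted (col e (u @ [(x, c), (z, c), (y, d)] @ v))" if "e \<in> C" for e
    using ch that by (simp only: rising_def)
  have "d \<noteq> c"
    using S[OF c] \<open>y < z\<close> by (auto simp: sorted_append)
  have Sc: "sorted (col c u @ x # z # col c v)"
    using S[OF c] \<open>d \<noteq> c\<close> by simp
  show ?thesis
  proof (cases "d \<in> C")
    case False
    have "sorted (col e (u @ [(z, d), (x, c), (y, c)] @ v))" if "e \<in> C" for e
    proof (cases "e = c")
      case True
      with Sc \<open>d \<noteq> c\<close> \<open>x \<le> y\<close> \<open>y < z\<close> show ?thesis by (force simp: sorted_append)
    next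
      case False
      with S[OF that] \<open>d \<notin> C\<close> that show ?thesis by auto
    qed
    then have "rising C (u @ [(z, d), (x, c), (y, c)] @ v)"
      by (simp only: rising_def) blast
    then show ?thesis by blast
  next
    case True
    have Sd: "sorted (col d u @ y # col d v)"
      using S[OF True] \<open>d \<noteq> c\<close> by simp
    have "sorted (col e (u @ [(z, d), (x, c), (y, c)] @ swap_colours c d v))" if "e \<in> C" for e
    proof -
      consider "e = c" | "e = d" | "e \<noteq> c" "e \<noteq> d" by blast
      then show ?thesis
      proof cases
        case 1
        with Sc Sd \<open>d \<noteq> c\<close> \<open>x \<le> y\<close> show ?thesis by (force simp: sorted_append)
      next
        case 2
        with Sc Sd \<open>d \<noteq> c\<close> \<open>y < z\<close> show ?thesis by (force simp: sorted_append)
      next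
        case 3
        with S[OF that] show ?thesis by simp
      qed
    qed
    then have "rising C (u @ [(z, d), (x, c), (y, c)] @ swap_colours c d v)"
      by (simp only: rising_def) blast
    with True c show ?thesis
      by (metis covered_swap_colours map_fst_swap_colours)
  qed
qed

text \<open>Here \<open>y\<close> precedes the separated entries. If it lies on no chain, it
  replaces \<open>x\<close> on chain \<open>c\<close> and \<open>x\<close> drops out; otherwise
  \<open>z\<close> follows \<open>y\<close> on chain \<open>d\<close>, while \<open>x\<close> stays
  on \<open>c\<close> and continues with the old tail of \<open>d\<close>. The two outcomes colour
  the three letters differently, hence the existential \<open>p\<close>.\<close>

lemma exchange_yxz:
  assumes ch: "rising C (u @ [(y, d), (x, c), (z, c)] @ v)" and c: "c \<in> C" and "x < y" "y \<le> z"
  shows "\<exists>p v'. rising C (u @ p @ v') \<and> map fst p = [y, z, x] \<and> map fst v' = map fst v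
    \<and> covered C (p @ v') = covered C ([(y, d), (x, c), (z, c)] @ v)"
proof -
  have S: "sorted (col e (u @ [(y, d), (x, c), (z, c)] @ v))" if "e \<in> C" for e
    using ch that by (simp only: rising_def)
  have "d \<noteq> c"
    using S[OF c] \<open>x < y\<close> by (auto simp: sorted_append)
  have Sc: "sorted (col c u @ x # z # col c v)"
    using S[OF c] \<open>d \<noteq> c\<close> by simp
  show ?thesis
  proof (cases "d \<in> C")
    case False
    have "sorted (col e (u @ [(y, c), (z, c), (x, d)] @ v))" if "e \<in> C" for e
    proof (cases "e = c")
      case True
      with Sc \<open>d \<noteq> c\<close> \<open>x < y\<close> \<open>y \<le> z\<close> show ?thesis by (force simp: sorted_append)
    next
      case False
      with S[OF that] \<open>d \<notin> C\<close> that show ?thesis by auto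
    qed
    then have "rising C (u @ [(y, c), (z, c), (x, d)] @ v)"
      by (simp only: rising_def) blast
    with False c show ?thesis
      by (intro exI[of _ "[(y, c), (z, c), (x, d)]"] exI[of _ v]) simp
  next
    case True
    have Sd: "sorted (col d u @ y # col d v)"
      using S[OF True] \<open>d \<noteq> c\<close> by simp
    have "sorted (col e (u @ [(y, d), (z, d), (x, c)] @ swap_colours c d v))" if "e \<in> C" for e
    proof -
      consider "e = c" | "e = d" | "e \<noteq> c" "e \<noteq> d" by blast
      then show ?thesis
      proof cases
        case 1
        with Sc Sd \<open>d \<noteq> c\<close> \<open>x < y\<close> show ?thesis by (force simp: sorted_append)
      next
        case 2
        with Sc Sd \<open>d \<noteq> c\<close> \<open>y \<le> z\<close> show ?thesis by (force simp: sorted_append)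
      next
        case 3
        with S[OF that] show ?thesis by simp
      qed
    qed
    then have "rising C (u @ [(y, d), (z, d), (x, c)] @ swap_colours c d v)"
      by (simp only: rising_def) blast
    with True c show ?thesis
      by (intro exI[of _ "[(y, d), (z, d), (x, c)]"] exI[of _ "swap_colours c d v"]) simp
  qed
qed

lemma map_fst_eq_append3E:
  assumes "map fst ps = u @ [a, b, c] @ v"
  obtains u' d e f v' where "ps = u' @ [(a, d), (b, e), (c, f)] @ v'" "map fst u' = u" "map fst v' = v"
  using assms by (auto simp: map_eq_append_conv map_eq_Cons_conv)

text \<open>The invariance behind Greene's theorem. A move disturbs a chain only if the two letters
  trading places lie on the same one, and then an exchange lemma repairs the colouring; in all other
  cases the colours travel with their letters.\<close>

lemma knuth_rising:
  assumes "knuth w w'" "map fst ps = w" "rising C ps"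
  shows "\<exists>ps'. map fst ps' = w' \<and> rising C ps' \<and> covered C ps' = covered C ps"
  using assms
proof (induction arbitrary: ps rule: knuth.induct)
  case (knuth_refl w)
  then show ?case by blast
next
  case (knuth_trans u v w)
  then show ?case by metis
next
  case (yxz x y z u v)
  from yxz.prems(1) obtain u' d e f v' where ps: "ps = u' @ [(y, d), (x, e), (z, f)] @ v'"
    and uv: "map fst u' = u" "map fst v' = v" by (rule map_fst_eq_append3E)
  show ?case
  proof (cases "e = f \<and> e \<in> C")
    case True
    then have "\<exists>p v''. rising C (u' @ p @ v'') \<and> map fst p = [y, z, x] \<and> map fst v'' = map fst v'
        \<and> covered C (p @ v'') = covered C ([(y, d), (x, e), (z, e)] @ v')"
      using yxz ps by (intro exchange_yxz) auto
    then obtain p v'' where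
      "rising C (u' @ p @ v'')" "map fst p = [y, z, x]" "map fst v'' = map fst v'"
      "covered C (p @ v'') = covered C ([(y, d), (x, e), (z, e)] @ v')"
      by (elim exE conjE) (rule that)
    with True uv ps show ?thesis by (intro exI[of _ "u' @ p @ v''"]) auto
  next
    case False
    with rising_swap_adjacent[of C "u' @ [(y, d)]" "(x, e)" "(z, f)" v'] yxz ps
    have "rising C (u' @ [(y, d), (z, f), (x, e)] @ v')" by auto
    with uv ps show ?thesis by (intro exI[of _ "u' @ [(y, d), (z, f), (x, e)] @ v'"]) auto
  qed
next
  case (yzx x y z u v)
  from yzx.prems(1) obtain u' d e f v' where ps: "ps = u' @ [(y, d), (z, e), (x, f)] @ v'"
    and uv: "map fst u' = u" "map fst v' = v" by (rule map_fst_eq_append3E)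
  \<comment> \<open>The letters \<open>z\<close> and \<open>x\<close> form a strict descent, so no
    chain of \<open>C\<close> contains both and a plain swap suffices.\<close>
  have "f \<notin> C" if "e = f"
    using rising_adjacent_le[of C "u' @ [(y, d)]" z e x v'] yzx that ps by auto
  with rising_swap_adjacent[of C "u' @ [(y, d)]" "(z, e)" "(x, f)" v'] yzx ps
  have "rising C (u' @ [(y, d), (x, f), (z, e)] @ v')" by auto
  with uv ps show ?case by (intro exI[of _ "u' @ [(y, d), (x, f), (z, e)] @ v'"]) auto
next
  case (xzy x y z u v)
  from xzy.prems(1) obtain u' d e f v' where ps: "ps = u' @ [(x, d), (z, e), (y, f)] @ v'"
    and uv: "map fst u' = u" "map fst v' = v" by (rule map_fst_eq_append3E)
  show ?case
  proof (cases "d = e \<and> d \<in> C")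
    case True
    with exchange_xzy[of C u' x d z y f v'] xzy ps obtain v'' where
      "rising C (u' @ [(z, f), (x, d), (y, d)] @ v'')" "map fst v'' = map fst v'"
      "covered C v'' = covered C v'" by auto
    with True uv ps show ?thesis
      by (intro exI[of _ "u' @ [(z, f), (x, d), (y, d)] @ v''"]) auto
  next
    case False
    with rising_swap_adjacent[of C u' "(x, d)" "(z, e)" "(y, f) # v'"] xzy ps
    have "rising C (u' @ [(z, e), (x, d), (y, f)] @ v')" by auto
    with uv ps show ?thesis by (intro exI[of _ "u' @ [(z, e), (x, d), (y, f)] @ v'"]) auto
  qed
next
  case (zxy x y z u v)
  from zxy.prems(1) obtain u' d e f v' where ps: "ps = u' @ [(z, d), (x, e), (y, f)] @ v'"
    and uv: "map fst u' = u" "map fst v' = v" by (rule map_fst_eq_append3E)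
  have "e \<notin> C" if "d = e"
    using rising_adjacent_le[of C u' z d x "(y, f) # v'"] zxy that ps by auto
  with rising_swap_adjacent[of C u' "(z, d)" "(x, e)" "(y, f) # v'"] zxy ps
  have "rising C (u' @ [(x, e), (z, d), (y, f)] @ v')" by auto
  with uv ps show ?case by (intro exI[of _ "u' @ [(x, e), (z, d), (y, f)] @ v'"]) auto
qed

subsection \<open>The reading word of the insertion tableau\<close>

definition reading :: "'a list list \<Rightarrow> 'a list" where
  "reading T = concat (rev T)"

lemma reading_simps [simp]:
  "reading [] = []"
  "reading (r # T) = reading T @ r"
  by (simp_all add: reading_def)

lemma row_insert_no_bump: "row_insert x r = (r', None) \<Longrightarrow> r' = r @ [x]"
  by (induction r arbitrary: r') (auto split: if_splits prod.splits)

lemma row_insert_not_Nil [simp]: "row_insert x r \<noteq> ([], b)"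
  by (cases r) (auto split: prod.splits)

lemma set_row_insert: "set (fst (row_insert x r)) \<subseteq> insert x (set r)"
  by (induction r) (auto split: prod.splits)

lemma row_insert_bump_less: "row_insert x r = (r', Some y) \<Longrightarrow> x < y"
  by (induction r arbitrary: r') (auto split: if_splits prod.splits)

lemma sorted_row_insert: "sorted r \<Longrightarrow> sorted (fst (row_insert x r))"
proof (induction r)
  case (Cons y r)
  then show ?case
    using set_row_insert[of x r] by (fastforce split: prod.splits)
qed simp

text \<open>The new letter \<open>x\<close> travels left; it passes each entry with the entry in
  front of that one as middle letter.\<close>

lemma knuth_bump_head: "sorted (y # r) \<Longrightarrow> x < y \<Longrightarrow> knuth (y # r @ [x]) (y # x # r)"
proof (induction r arbitrary: y)
  case (Cons z r)
  have "knuth (z # r @ [x]) (z # x # r)" using Cons by auto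
  then have "knuth (y # z # r @ [x]) (y # z # x # r)"
    using knuth_context[of _ _ "[y]" "[]"] by fastforce
  moreover have "knuth (y # z # x # r) (y # x # z # r)"
    using Cons knuth.yzx[of x y z "[]" r] by auto
  ultimately show ?case by (auto intro: knuth.knuth_trans)
qed (simp add: knuth.knuth_refl)

text \<open>First \<open>x\<close> moves left until it stands next to the entry it bumps, then the
  bumped \<open>y\<close> moves left to the front.\<close>

lemma knuth_row_insert:
  "sorted r \<Longrightarrow> row_insert x r = (r', Some y) \<Longrightarrow> knuth (r @ [x]) (y # r')"
proof (induction r arbitrary: r')
  case (Cons a r)
  show ?case
  proof (cases "x < a")
    case True
    with Cons show ?thesis by (auto intro: knuth_bump_head)
  next
    case False
    with Cons obtain s where s: "row_insert x r = (s, Some y)" "r' = a # s"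
      by (auto split: prod.splits)
    then obtain h t where h: "s = h # t" by (cases s) auto
    have "knuth (r @ [x]) (y # s)" using Cons s by auto
    then have "knuth (a # r @ [x]) (a # y # s)"
      using knuth_context[of _ _ "[a]" "[]"] by fastforce
    \<comment> \<open>The head \<open>h\<close> of the new remainder is \<open>x\<close> or an old
      entry that is at most \<open>x\<close>; it is the middle letter of the move taking
      \<open>y\<close> past \<open>a\<close>.\<close>
    moreover have "a \<le> h" "h < y"
      using s h False Cons.prems row_insert_bump_less[OF s(1)]
      by (cases r; auto split: if_splits prod.splits)+
    then have "knuth (a # y # s) (y # a # s)"
      using knuth.xzy[of a h y "[]" t] h by auto
    ultimately show ?thesis using s by (auto intro: knuth.knuth_trans)
  qed
qed simp

section \<open>Column strictness under insertion\<close>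

fun dominates :: "'a::linorder list \<Rightarrow> 'a list \<Rightarrow> bool" where
  "dominates r [] = True"
| "dominates [] (b # s) = False"
| "dominates (a # r) (b # s) = (a < b \<and> dominates r s)"

fun tableau :: "'a::linorder list list \<Rightarrow> bool" where
  "tableau [] = True"
| "tableau (r # T) = (sorted r \<and> (T \<noteq> [] \<longrightarrow> dominates r (hd T)) \<and> tableau T)"

lemma dominates_row_insert: "dominates r s \<Longrightarrow> dominates (fst (row_insert x r)) s"
proof (induction r s rule: dominates.induct)
  case (3 a r b s)
  then show ?case by (auto split: prod.splits)
qed auto

text \<open>The bumped \<open>y\<close> lands in the next row no further right than the column it
  left, because an entry below its old place exceeds it.\<close>

lemma dominates_row_insert_bump:
  "sorted r \<Longrightarrow> dominates r s \<Longrightarrow> row_insert x r = (r', Some y) \<Longrightarrow>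
    dominates r' (fst (row_insert y s))"
proof (induction r arbitrary: s r')
  case (Cons a r)
  show ?case
  proof (cases "x < a")
    case True
    with Cons.prems show ?thesis by (cases s) auto
  next
    case False
    with Cons.prems obtain t where t: "row_insert x r = (t, Some y)" "r' = a # t"
      by (auto split: prod.splits)
    with False row_insert_bump_less[OF t(1)] Cons dominates_row_insert[of r _ x]
    show ?thesis by (cases s) (fastforce split: prod.splits)+
  qed
qed auto

lemma hd_tableau_insert:
  "hd (tableau_insert x T) = fst (row_insert x (if T = [] then [] else hd T))" "tableau_insert x T \<noteq> []"
  by (cases T; auto split: prod.splits option.splits)+

lemma tableau_insert_tableau: "tableau T \<Longrightarrow> tableau (tableau_insert x T)"
proof (induction T arbitrary: x)
  case (Cons r T)
  obtain r' b where rb: "row_insert x r = (r', b)" by fastforce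
  have *: "sorted r'" using sorted_row_insert[of r x] rb Cons by auto
  show ?case
  proof (cases b)
    case None
    with rb * Cons dominates_row_insert[of r "hd T" x] show ?thesis by auto
  next
    case (Some y)
    have "dominates r' (hd (tableau_insert y T))"
      using dominates_row_insert_bump[of r _ x r' y] rb Some Cons.prems
      by (auto simp: hd_tableau_insert)
    with rb * Some Cons show ?thesis by auto
  qed
qed simp

lemma knuth_tableau_insert:
  "tableau T \<Longrightarrow> knuth (reading T @ [x]) (reading (tableau_insert x T))"
proof (induction T arbitrary: x)
  case (Cons r T)
  obtain r' b where rb: "row_insert x r = (r', b)" by fastforce
  show ?case
  proof (cases b)
    case None
    with rb row_insert_no_bump[of x r r'] show ?thesis by (auto intro: knuth.knuth_refl)
  next
    case (Some y)
    have "knuth (reading T @ (r @ [x]) @ []) (reading T @ (y # r') @ [])"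
      using knuth_row_insert[of r x r' y] rb Some Cons.prems by (intro knuth_context) auto
    moreover have "knuth ([] @ (reading T @ [y]) @ r') ([] @ reading (tableau_insert y T) @ r')"
      using Cons by (intro knuth_context) auto
    ultimately show ?thesis using rb Some by (auto intro: knuth.knuth_trans)
  qed
qed (simp add: knuth.knuth_refl)

lemma insertion_tableau_snoc: "insertion_tableau (w @ [x]) = tableau_insert x (insertion_tableau w)"
  by (simp add: insertion_tableau_def)

lemma tableau_insertion_tableau: "tableau (insertion_tableau w)"
proof (induction w rule: rev_induct)
  case (snoc x w)
  then show ?case by (simp add: insertion_tableau_snoc tableau_insert_tableau)
qed (simp add: insertion_tableau_def)

lemma knuth_insertion_tableau: "knuth w (reading (insertion_tableau w))"
proof (induction w rule: rev_induct)
  case (snoc x w)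
  have "knuth (w @ [x]) (reading (insertion_tableau w) @ [x])"
    using knuth_context[OF snoc, of "[]" "[x]"] by simp
  then show ?case
    using knuth_tableau_insert[OF tableau_insertion_tableau]
    by (auto simp: insertion_tableau_snoc intro: knuth.knuth_trans)
qed (simp add: insertion_tableau_def knuth.knuth_refl)

subsection \<open>Greene's theorem\<close>

lemma dominates_nth:
  "dominates r s \<Longrightarrow> length s \<le> length r \<and> (\<forall>j<length s. r ! j < s ! j)"
proof (induction r s rule: dominates.induct)
  case (3 a r b s)
  then show ?case by (auto simp: nth_Cons split: nat.splits)
qed auto

lemma tableau_nth:
  "tableau T \<Longrightarrow> i < i' \<Longrightarrow> i' < length T \<Longrightarrow>
    length (T ! i') \<le> length (T ! i) \<and> (\<forall>j<length (T ! i'). T ! i ! j < T ! i' ! j)"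
proof (induction T arbitrary: i i')
  case (Cons r T)
  then obtain k where k: "i' = Suc k" "k < length T" by (cases i') auto
  show ?case
  proof (cases i)
    case (Suc l)
    with k Cons show ?thesis by auto
  next
    case 0
    have d: "dominates r (T ! 0)" using k Cons.prems by (cases T) auto
    show ?thesis
    proof (cases k)
      case 0
      with dominates_nth[OF d] k \<open>i = 0\<close> show ?thesis by auto
    next
      case (Suc l)
      then have "length (T ! k) \<le> length (T ! 0) \<and> (\<forall>j<length (T ! k). T ! 0 ! j < T ! k ! j)"
        using k Cons by auto
      with dominates_nth[OF d] k \<open>i = 0\<close> show ?thesis by simp (meson order.strict_trans order.strict_trans2)
    qed
  qed
qed simp

section \<open>Upper bound by counting cells along columns\<close>

lemma map_fst_reading:
  "map fst ps = reading T \<Longrightarrow> \<exists>P. ps = reading P \<and> map (map fst) P = T"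
proof (induction T arbitrary: ps)
  case (Cons r T)
  then obtain qs rs where "ps = qs @ rs" "map fst qs = reading T" "map fst rs = r"
    by (auto simp: map_eq_append_conv)
  with Cons.IH[of qs] show ?case
    by (metis list.simps(9) reading_simps(2))
qed simp

lemma set_reading: "set (reading T) = (\<Union>r\<in>set T. set r)"
  by (simp add: reading_def)

lemma covered_reading: "covered C (reading P) = (\<Sum>i<length P. covered C (P ! i))"
proof (induction P)
  case (Cons r P)
  then show ?case by (simp add: sum.lessThan_Suc_shift del: sum.lessThan_Suc)
qed simp

text \<open>Lower rows are read first, so along a chain they contribute the earlier entries.\<close>

lemma rising_reading_rows:
  "rising C (reading P) \<Longrightarrow> i < i' \<Longrightarrow> i' < length P \<Longrightarrow> (x, c) \<in> set (P ! i) \<Longrightarrow>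
    (y, c) \<in> set (P ! i') \<Longrightarrow> c \<in> C \<Longrightarrow> y \<le> x"
proof (induction P arbitrary: i i')
  case (Cons r P)
  then obtain k where k: "i' = Suc k" "k < length P" by (cases i') auto
  have "y \<in> set (col c (reading P))"
    using Cons.prems k by (auto simp: in_set_col set_reading)
  moreover have "x \<in> set (col c r)" if "i = 0"
    using Cons.prems that by (auto simp: in_set_col)
  moreover have "rising C (reading P)" "\<forall>a\<in>set (col c (reading P)). \<forall>b\<in>set (col c r). a \<le> b"
    using Cons.prems by (auto simp: rising_def sorted_append)
  ultimately show ?case
    using Cons k by (cases i) auto
qed simp

lemma covered_card: "covered C ps = card {j. j < length ps \<and> snd (ps ! j) \<in> C}"
  by (simp add: covered_def length_filter_conv_card)

text \<open>Meant for the rows \<open>H\<close> of one column and the rows \<open>A\<close> in which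
  chains meet it: \<open>H\<close> is an initial segment, so its intersection with
  \<open>{..<k}\<close> has \<open>min (card H) k\<close> elements.\<close>

lemma card_interval_Int_down_closed:
  fixes H A :: "nat set"
  assumes "finite H" "A \<subseteq> H" "card A \<le> k" and down: "\<And>i i'. i' \<in> H \<Longrightarrow> i < i' \<Longrightarrow> i \<in> H"
  shows "card A \<le> card (H \<inter> {..<k})"
proof (cases "H \<subseteq> {..<k}")
  case True
  with assms show ?thesis by (simp add: Int_absorb2 card_mono)
next
  case False
  then obtain i where "i \<in> H" "k \<le> i"
    by (metis lessThan_iff linorder_not_less subsetI)
  then have "H \<inter> {..<k} = {..<k}"
    using down by (metis inf.absorb2 lessThan_iff order.strict_trans2 subsetI)
  with assms show ?thesis by simp
qed

text \<open>A column of the tableau is strictly decreasing when read from bottom to top, so it meets every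
  weakly increasing chain at most once.\<close>

lemma covered_tableau_le:
  fixes C :: "'c set"
  assumes T: "tableau T" and ps: "map fst ps = reading T" and "rising C ps"
    and C: "finite C" "card C = k"
  shows "covered C ps \<le> (\<Sum>i | i < length T \<and> i < k. length (T ! i))"
proof -
  obtain P where P: "ps = reading P" "map (map fst) P = T"
    using map_fst_reading[OF ps] by blast
  \<comment> \<open>The number of cells bounds every row length, so all sums over columns can share
    the range \<open>{..<N}\<close>.\<close>
  define N where "N = (\<Sum>i<length T. length (T ! i))"
  have lenT: "length T = length P" "\<And>i. i < length P \<Longrightarrow> length (T ! i) = length (P ! i)"
    using P by auto
  have N: "length (T ! i) \<le> N" if "i < length T" for i
    unfolding N_def using that by (intro member_le_sum) auto
  \<comment> \<open>\<open>A j\<close> holds the rows whose cell in column \<open>j\<close> lies on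
    a chain, \<open>H j\<close> all rows reaching column \<open>j\<close>.\<close>
  define A where "A j = {i. i < length P \<and> j < length (P ! i) \<and> snd (P ! i ! j) \<in> C}" for j
  define H where "H j = {i. i < length P \<and> j < length (P ! i)}" for j
  have le: "card (A j) \<le> card (H j \<inter> {..<k})" for j
  proof (rule card_interval_Int_down_closed)
    show "finite (H j)" "A j \<subseteq> H j" by (auto simp: A_def H_def)
    have "inj_on (\<lambda>i. snd (P ! i ! j)) (A j)"
    proof (rule linorder_inj_onI)
      fix i i' assume *: "i < i'" "i \<in> A j" "i' \<in> A j"
      show "snd (P ! i ! j) \<noteq> snd (P ! i' ! j)"
      proof
        assume eq: "snd (P ! i ! j) = snd (P ! i' ! j)"
        have "(fst (P ! i ! j), snd (P ! i ! j)) \<in> set (P ! i)"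
          "(fst (P ! i' ! j), snd (P ! i' ! j)) \<in> set (P ! i')"
          using * by (simp_all add: A_def)
        then have "fst (P ! i' ! j) \<le> fst (P ! i ! j)"
          using assms(3) * eq unfolding P(1)
          by (intro rising_reading_rows[of C P i i' _ "snd (P ! i ! j)"]) (simp_all add: A_def)
        moreover have "T ! i ! j < T ! i' ! j"
          using tableau_nth[OF T, of i i'] * lenT by (auto simp: A_def)
        ultimately show False
          using * P(2) by (auto simp: A_def)
      qed
    qed auto
    then have "card (A j) \<le> card C"
      using C by (intro card_inj_on_le) (auto simp: A_def)
    then show "card (A j) \<le> k" using C by simp
    show "i \<in> H j" if "i' \<in> H j" "i < i'" for i i'
      using tableau_nth[OF T, of i i'] that lenT by (auto simp: H_def)
  qed
  \<comment> \<open>Double counting: the covered cells are summed by rows, then by columns where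
    \<open>le\<close> applies, and the bound is summed by rows again.\<close>
  have "covered C ps = (\<Sum>i<length P. \<Sum>j<N. if i \<in> A j then 1 else 0)"
    unfolding P(1) covered_reading
  proof (rule sum.cong[OF refl])
    fix i assume i: "i \<in> {..<length P}"
    have "(\<Sum>j<N. if i \<in> A j then 1 else 0) = card {j \<in> {..<N}. i \<in> A j}"
      by (simp add: sum.If_cases Int_def)
    also have "{j \<in> {..<N}. i \<in> A j} = {j. j < length (P ! i) \<and> snd (P ! i ! j) \<in> C}"
      using N[of i] lenT i by (auto simp: A_def)
    finally show "covered C (P ! i) = (\<Sum>j<N. if i \<in> A j then 1 else 0)"
      by (simp add: covered_card)
  qed
  also have "\<dots> = (\<Sum>j<N. \<Sum>i<length P. if i \<in> A j then 1 else 0)"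
    by (rule sum.swap)
  also have "\<dots> = (\<Sum>j<N. card (A j))"
    by (intro sum.cong) (auto simp: sum.If_cases A_def Int_def)
  also have "\<dots> \<le> (\<Sum>j<N. card (H j \<inter> {..<k}))"
    by (intro sum_mono le)
  also have "\<dots> = (\<Sum>j<N. \<Sum>i | i < length P \<and> i < k. if j < length (P ! i) then 1 else 0)"
    by (intro sum.cong) (auto simp: sum.If_cases H_def Int_def intro!: arg_cong[of _ _ card])
  also have "\<dots> = (\<Sum>i | i < length P \<and> i < k. \<Sum>j<N. if j < length (P ! i) then 1 else 0)"
    by (rule sum.swap)
  also have "\<dots> = (\<Sum>i | i < length T \<and> i < k. length (T ! i))"
  proof (intro sum.cong)
    fix i assume i: "i \<in> {i. i < length T \<and> i < k}"
    then have "{..<N} \<inter> {j. j < length (P ! i)} = {..<length (P ! i)}"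
      using N[of i] lenT by auto
    with i show "(\<Sum>j<N. if j < length (P ! i) then 1 else 0) = length (T ! i)"
      using lenT by (simp add: sum.If_cases)
  qed (simp add: lenT)
  finally show ?thesis .
qed

lemma sum_sh:
  "(\<Sum>i<k. sh w i) =
    (\<Sum>i | i < length (insertion_tableau w) \<and> i < k. length (insertion_tableau w ! i))"
proof -
  have "{..<k} \<inter> {i. i < length (insertion_tableau w)} = {i. i < length (insertion_tableau w) \<and> i < k}"
    by auto
  then show ?thesis by (simp add: sh_def Let_def sum.If_cases)
qed

text \<open>The colouring is carried along Knuth moves to the reading word of the tableau, where the
  columns bound its coverage.\<close>

theorem greene_upper:
  assumes "rising C ps" "finite C" "card C = k"
  shows "covered C ps \<le> (\<Sum>i<k. sh (map fst ps) i)"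
proof -
  obtain ps' where "map fst ps' = reading (insertion_tableau (map fst ps))" "rising C ps'"
    "covered C ps' = covered C ps"
    using knuth_rising[OF knuth_insertion_tableau refl] assms by metis
  with covered_tableau_le[OF tableau_insertion_tableau] assms show ?thesis
    by (metis sum_sh)
qed

text \<open>Each row is a chain and receives its own index as colour. For the induction,
  \<open>n\<close> is the index of the top row of \<open>T\<close>; the lower bound on colours keeps
  colour \<open>n\<close> free for that row.\<close>

lemma tableau_rows_rising:
  assumes "tableau T"
  shows "\<exists>ps. map fst ps = reading T \<and> rising {..<k} ps \<and>
    (\<forall>p\<in>set ps. n \<le> snd p) \<and>
    covered {..<k} ps = (\<Sum>i | i < length T \<and> n + i < k. length (T ! i))"
  using assms
proof (induction T arbitrary: n)
  case (Cons r T)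
  then obtain ps where ps: "map fst ps = reading T" "rising {..<k} ps" "\<forall>p\<in>set ps. Suc n \<le> snd p"
    "covered {..<k} ps = (\<Sum>i | i < length T \<and> Suc n + i < k. length (T ! i))" by fastforce
  let ?q = "map (\<lambda>x. (x, n)) r"
  have q: "col c ?q = (if c = n then r else [])" for c by (induction r) auto
  have "col n ps = []" using ps(3) by (force simp: col_def filter_empty_conv)
  then have "rising {..<k} (ps @ ?q)"
    using ps(2) Cons.prems by (auto simp: rising_def q)
  moreover have "covered {..<k} ?q = (if n < k then length r else 0)"
    by (induction r) auto
  moreover have "(\<Sum>i | i < length (r # T) \<and> n + i < k. length ((r # T) ! i)) =
      covered {..<k} ps + (if n < k then length r else 0)"
  proof (cases "n < k")
    case True
    then have "{i. i < length (r # T) \<and> n + i < k} =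
        insert 0 (Suc ` {i. i < length T \<and> Suc n + i < k})"
      by (auto simp: image_iff less_Suc_eq_0_disj)
    with True show ?thesis by (simp add: ps(4) sum.reindex)
  qed (simp add: ps(4))
  ultimately show ?case
    using ps by (intro exI[of _ "ps @ ?q"]) (auto simp: comp_def)
qed (simp add: rising_def)

theorem greene_attained:
  "\<exists>ps. map fst ps = w \<and> rising {..<k} ps \<and> covered {..<k} ps = (\<Sum>i<k. sh w i)"
proof -
  obtain ps where "map fst ps = reading (insertion_tableau w)" "rising {..<k} ps"
    "covered {..<k} ps = (\<Sum>i<k. sh w i)"
    using tableau_rows_rising[OF tableau_insertion_tableau, of w k 0] by (auto simp: sum_sh)
  with knuth_rising[OF knuth_sym[OF knuth_insertion_tableau[of w]]] show ?thesis by metis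
qed

subsection \<open>Decomposing separable permutations\<close>

text \<open>For (<) the forbidden pattern is 3142, for (>) it is 2413.\<close>

definition avoids :: "('a \<Rightarrow> 'a \<Rightarrow> bool) \<Rightarrow> 'a list \<Rightarrow> bool" where
  "avoids R s \<longleftrightarrow> (\<forall>a b c d. subseq [a, b, c, d] s \<longrightarrow> \<not> (R b d \<and> R d a \<and> R a c))"

lemma avoids_subseq: "avoids R s \<Longrightarrow> subseq t s \<Longrightarrow> avoids R t"
  unfolding avoids_def by (blast intro: subseq_order.order_trans)

text \<open>For \<open>(<)\<close> this is a decomposition as a direct sum, for \<open>(>)\<close>
  as a skew sum.\<close>

definition splits :: "('a \<Rightarrow> 'a \<Rightarrow> bool) \<Rightarrow> 'a list \<Rightarrow> bool" where
  "splits R s \<longleftrightarrow> (\<exists>ys zs. s = ys @ zs \<and> ys \<noteq> [] \<and> zs \<noteq> [] \<and> (\<forall>y\<in>set ys. \<forall>z\<in>set zs. R y z))"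

text \<open>If the appended entry \<open>x\<close>
  destroys the split \<open>ys @ zs\<close>, then by avoidance the entries of \<open>ys\<close> below \<open>x\<close> precede those above.\<close>

lemma splits_snoc:
  fixes R :: "'a \<Rightarrow> 'a \<Rightarrow> bool"
  assumes total: "\<And>a b. a \<noteq> b \<Longrightarrow> R a b \<or> R b a" and trans: "transp R"
    and "x \<notin> set s" and avoid: "avoids R (s @ [x])" and "splits R s"
  shows "splits R (s @ [x]) \<or> splits R\<inverse>\<inverse> (s @ [x])"
proof -
  obtain ys zs where s: "s = ys @ zs" and ne: "ys \<noteq> []" "zs \<noteq> []"
    and R: "\<And>y z. y \<in> set ys \<Longrightarrow> z \<in> set zs \<Longrightarrow> R y z"
    using \<open>splits R s\<close> by (auto simp: splits_def)
  \<comment> \<open>In terms of the order \<open>R\<close>: \<open>x\<close> extends the upper block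
    \<open>zs\<close>, or lies below everything and splits off in the reverse order, or cuts through
    \<open>ys\<close>.\<close>
  consider "\<forall>y\<in>set ys. R y x" | "\<forall>y\<in>set s. R x y"
    | "\<exists>y\<in>set ys. R x y" "\<exists>u\<in>set s. \<not> R x u"
    using total[of x] \<open>x \<notin> set s\<close> s by (metis Un_iff set_append)
  then show ?thesis
  proof cases
    case 1
    with s ne R have "splits R (s @ [x])"
      unfolding splits_def by (intro exI[of _ ys] exI[of _ "zs @ [x]"]) auto
    then show ?thesis ..
  next
    case 2
    with s ne have "splits R\<inverse>\<inverse> (s @ [x])"
      unfolding splits_def by (intro exI[of _ s] exI[of _ "[x]"]) auto
    then show ?thesis ..
  next
    case 3
    then obtain y u where y: "y \<in> set ys" "R x y" and u: "u \<in> set s" "\<not> R x u" by blast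
    obtain z where z: "z \<in> set zs" using ne by (cases zs) auto
    define ys1 where "ys1 = takeWhile (\<lambda>a. R a x) ys"
    define ys2 where "ys2 = dropWhile (\<lambda>a. R a x) ys"
    have ys: "ys = ys1 @ ys2" by (simp add: ys1_def ys2_def)
    have below: "R a x" if "a \<in> set ys1" for a
      using that set_takeWhileD unfolding ys1_def by fast
    have above: "R x b" if "b \<in> set ys2" for b
    proof (rule ccontr)
      assume "\<not> R x b"
      with that total[of b x] \<open>x \<notin> set s\<close> s ys have "R b x" by auto
      have "ys2 \<noteq> []" using that by auto
      then obtain h t where ht: "ys2 = h # t" "\<not> R h x"
        unfolding ys2_def by (metis hd_Cons_tl hd_dropWhile)
      have "R x h" using ht total[of x h] \<open>x \<notin> set s\<close> s ys by auto
      have "b \<in> set t" using ht that \<open>R b x\<close> by auto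
      \<comment> \<open>An entry \<open>h\<close> above \<open>x\<close> followed by
        \<open>b\<close> below it would complete the forbidden pattern together with
        \<open>z\<close> and \<open>x\<close>.\<close>
      have "subseq ([h] @ [b] @ [z] @ [x]) ((ys1 @ [h]) @ t @ zs @ [x])"
        using \<open>b \<in> set t\<close> z by (intro list_emb_append_mono) (auto simp: subseq_singleton_left)
      then have "subseq [h, b, z, x] (s @ [x])" by (simp add: s ys ht)
      moreover have "R h z" using R ys ht z by auto
      ultimately show False
        using avoid \<open>R b x\<close> \<open>R x h\<close> unfolding avoids_def by blast
    qed
    \<comment> \<open>Otherwise \<open>x\<close> would lie below all of \<open>ys\<close> and, by
      transitivity, below \<open>zs\<close>, contradicting \<open>u\<close>.\<close>
    have "ys1 \<noteq> []"
    proof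
      assume "ys1 = []"
      then have "R x a" if "a \<in> set s" for a
        using that above y R trans s ys by (auto dest: transpD)
      with u show False by blast
    qed
    have "R a b" if "a \<in> set ys1" "b \<in> set (ys2 @ zs @ [x])" for a b
      using that below above R ys by (auto intro: transpD[OF trans])
    moreover have "s @ [x] = ys1 @ (ys2 @ zs @ [x])" by (simp add: s ys)
    ultimately have "splits R (s @ [x])"
      unfolding splits_def using \<open>ys1 \<noteq> []\<close> by (intro exI[of _ ys1] exI[of _ "ys2 @ zs @ [x]"]) auto
    then show ?thesis ..
  qed
qed

text \<open>The last entry is appended to a shorter sequence that splits in one of the two orders;
  \<open>splits_snoc\<close> for that order uses the matching avoidance condition.\<close>

lemma avoids_splits:
  fixes s :: "'a::linorder list"
  assumes "distinct s" "avoids (<) s" "avoids (>) s" "2 \<le> length s"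
  shows "splits (<) s \<or> splits (>) s"
  using assms
proof (induction s rule: rev_induct)
  case (snoc x s)
  have conv: "(<)\<inverse>\<inverse> = ((>) :: 'a \<Rightarrow> 'a \<Rightarrow> bool)" "(>)\<inverse>\<inverse> = ((<) :: 'a \<Rightarrow> 'a \<Rightarrow> bool)"
    by auto
  show ?case
  proof (cases "2 \<le> length s")
    case True
    have "avoids (<) s" "avoids (>) s"
      using snoc.prems by (auto elim: avoids_subseq)
    with True snoc consider "splits (<) s" | "splits (>) s" by auto
    then show ?thesis
    proof cases
      case 1
      with snoc.prems have "splits (<) (s @ [x]) \<or> splits (<)\<inverse>\<inverse> (s @ [x])"
        by (intro splits_snoc) (auto simp: neq_iff)
      then show ?thesis by (auto simp only: conv)
    next
      case 2
      with snoc.prems have "splits (>) (s @ [x]) \<or> splits (>)\<inverse>\<inverse> (s @ [x])"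
        by (intro splits_snoc) (auto simp: neq_iff)
      then show ?thesis by (auto simp only: conv)
    qed
  next
    case False
    with snoc.prems obtain y where "s = [y]" by (cases s; cases "tl s") auto
    have pair: "splits R ([y] @ [x])" if "R y x" for R :: "'a \<Rightarrow> 'a \<Rightarrow> bool"
      unfolding splits_def using that by (intro exI[of _ "[y]"] exI[of _ "[x]"]) simp
    have "y < x \<or> x < y"
      using snoc.prems \<open>s = [y]\<close> by (simp add: neq_iff)
    with pair[of "(<)"] pair[of "(>)"] \<open>s = [y]\<close> show ?thesis by metis
  qed
qed simp

section \<open>From forbidden subsequences to pattern occurrences\<close>

lemma subseq_indices:
  "subseq xs ys \<Longrightarrow> \<exists>f. strict_mono_on {..<length xs} f \<and>
    (\<forall>j<length xs. f j < length ys \<and> ys ! f j = xs ! j)"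
proof (induction rule: list_emb.induct)
  case (list_emb_Nil ys)
  then show ?case by (auto simp: strict_mono_on_def)
next
  case (list_emb_Cons xs ys y)
  then obtain f where "strict_mono_on {..<length xs} f"
    "\<forall>j<length xs. f j < length ys \<and> ys ! f j = xs ! j" by blast
  then show ?case
    by (intro exI[of _ "\<lambda>j. Suc (f j)"]) (auto simp: strict_mono_on_def)
next
  case (list_emb_Cons2 x y xs ys)
  then obtain f where "strict_mono_on {..<length xs} f"
    "\<forall>j<length xs. f j < length ys \<and> ys ! f j = xs ! j" by blast
  with list_emb_Cons2(1) show ?case
    by (intro exI[of _ "case_nat 0 (\<lambda>j. Suc (f j))"])
       (auto simp: strict_mono_on_def nth_Cons split: nat.splits)
qed

lemma contains_pattern_4I:
  assumes "subseq [a, b, c, d] w" and "length p = 4"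
    and iff: "\<forall>j<4. \<forall>k<4. [a, b, c, d] ! j < [a, b, c, d] ! k \<longleftrightarrow> p ! j < p ! k"
  shows "contains_pattern w p"
proof -
  obtain f where f: "strict_mono_on {..<4} f"
    "\<And>j. j < 4 \<Longrightarrow> f j < length w \<and> w ! f j = [a, b, c, d] ! j"
    using subseq_indices[OF assms(1)] by (auto simp: numeral_eq_Suc)
  with iff \<open>length p = 4\<close> show ?thesis
    unfolding contains_pattern_def by (intro exI[of _ f]) metis
qed

lemma all_less_4: "(\<forall>j<4. P j) \<longleftrightarrow> P 0 \<and> P 1 \<and> P 2 \<and> P (3 :: nat)"
  by (simp add: numeral_eq_Suc All_less_Suc conj_ac)

lemma separable_avoids:
  assumes "separable s"
  shows "avoids (<) s" "avoids (>) s"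
proof -
  have "contains_pattern s [3, 1, 4, 2]" if "subseq [a, b, c, d] s" "b < d" "d < a" "a < c" for a b c d
    using that(2-) by (intro contains_pattern_4I[OF that(1)]) (simp_all add: all_less_4)
  moreover have "contains_pattern s [2, 4, 1, 3]" if "subseq [a, b, c, d] s" "b > d" "d > a" "a > c" for a b c d
    using that(2-) by (intro contains_pattern_4I[OF that(1)]) (simp_all add: all_less_4)
  ultimately show "avoids (<) s" "avoids (>) s"
    using assms unfolding separable_def avoids_def by blast+
qed

subsection \<open>Chains left over by a family of chains\<close>

text \<open>The least choice of \<open>h\<close> is the decreasing merge of \<open>f\<close> and \<open>g\<close>, the shape of a skew sum.\<close>

lemma sum_merge_le:
  fixes f g h :: "nat \<Rightarrow> nat"
  assumes "antimono f" "antimono g" "\<And>k. \<exists>a b. a + b = k \<and> max (f a) (g b) \<le> h k"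
  shows "(\<Sum>k<m. f k) + (\<Sum>k<n. g k) \<le> (\<Sum>k<m + n. h k)"
  using assms
proof (induction l \<equiv> "m + n" arbitrary: m n f g h)
  case (Suc l)
  \<comment> \<open>By symmetry \<open>f 0\<close> may be taken as the larger leading value. It is
    at most \<open>h 0\<close>, and both are removed.\<close>
  have step: "(\<Sum>k<m. f k) + (\<Sum>k<n. g k) \<le> (\<Sum>k<m + n. h k)"
    if le: "g 0 \<le> f 0" and anti: "antimono f" "antimono g"
      and merge: "\<And>k. \<exists>a b. a + b = k \<and> max (f a) (g b) \<le> h k"
      and mn: "Suc l = m + n" for f g :: "nat \<Rightarrow> nat" and m n
  proof (cases m)
    case 0
    have "g k \<le> h k" for k
    proof -
      obtain a b where "a + b = k" "max (f a) (g b) \<le> h k" using merge by blast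
      moreover have "g k \<le> g b" using anti(2) \<open>a + b = k\<close> by (auto intro: antimonoD)
      ultimately show ?thesis by simp
    qed
    with 0 show ?thesis by (simp add: sum_mono)
  next
    case (Suc m')
    have "\<exists>a b. a + b = k \<and> max (f (Suc a)) (g b) \<le> h (Suc k)" for k
    proof -
      obtain a b where ab: "a + b = Suc k" "max (f a) (g b) \<le> h (Suc k)" using merge by blast
      show ?thesis
      proof (cases a)
        \<comment> \<open>A witness with \<open>a = 0\<close> cannot be shifted, but then
          \<open>f 0\<close> bounds both \<open>f (Suc 0)\<close> and \<open>g k\<close>.\<close>
        case 0
        have "f (Suc 0) \<le> f 0" "g k \<le> g 0" using anti by (auto intro: antimonoD)
        with ab 0 le show ?thesis by (intro exI[of _ 0] exI[of _ k]) auto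
      next
        case (Suc a')
        with ab show ?thesis by (intro exI[of _ a'] exI[of _ b]) auto
      qed
    qed
    moreover have "antimono (\<lambda>k. f (Suc k))"
      using anti(1) by (auto simp: antimono_def)
    ultimately have "(\<Sum>k<m'. f (Suc k)) + (\<Sum>k<n. g k) \<le> (\<Sum>k<m' + n. h (Suc k))"
      using Suc.hyps(1)[of m' n "\<lambda>k. f (Suc k)" g "\<lambda>k. h (Suc k)"] mn Suc anti by simp
    moreover have "f 0 \<le> h 0" using merge[of 0] by auto
    ultimately show ?thesis
      using Suc by (simp add: sum.lessThan_Suc_shift del: sum.lessThan_Suc)
  qed
  show ?case
  proof (cases "g 0 \<le> f 0")
    case True
    with step Suc.prems Suc.hyps(2) show ?thesis by blast
  next
    case False
    have "\<exists>a b. a + b = k \<and> max (g a) (f b) \<le> h k" for k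
      using Suc.prems(3)[of k] by (metis add.commute max.commute)
    with False step[of f g n m] Suc.prems Suc.hyps(2) show ?thesis by (simp add: add.commute)
  qed
qed simp

text \<open>\<open>C\<close> ranges over all finite colour sets, not only initial segments, so that
  the colours can be divided between the two parts of a skew sum.\<close>

definition residual :: "(nat \<Rightarrow> nat) \<Rightarrow> nat list \<Rightarrow> bool" where
  "residual \<mu> s \<longleftrightarrow> (\<forall>(C :: nat set) ps. finite C \<longrightarrow> rising C ps \<longrightarrow> map fst ps = s \<longrightarrow>
     (\<exists>ts. subseq ts ps \<and> sorted (map fst ts) \<and> snd ` set ts \<inter> C = {} \<and> \<mu> (card C) \<le> length ts))"

lemma residualE:
  fixes C :: "nat set"
  assumes "residual \<mu> s" "finite C" "rising C ps" "map fst ps = s"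
  obtains ts where "subseq ts ps" "sorted (map fst ts)" "snd ` set ts \<inter> C = {}"
    "\<mu> (card C) \<le> length ts"
  using assms unfolding residual_def by blast

lemma set_subseq: "subseq ts ps \<Longrightarrow> set ts \<subseteq> set ps"
  by (metis subseq_conv_nths set_nths_subset)

lemma residual_Nil: "residual (\<lambda>_. 0) []"
  by (auto simp: residual_def)

lemma residual_singleton: "residual (\<lambda>k. if k = 0 then 1 else 0) [x]"
  unfolding residual_def
proof (intro allI impI)
  fix C :: "nat set" and ps :: "(nat \<times> nat) list"
  assume C: "finite C" "map fst ps = [x]"
  show "\<exists>ts. subseq ts ps \<and> sorted (map fst ts) \<and> snd ` set ts \<inter> C = {} \<and>
    (if card C = 0 then 1 else 0) \<le> length ts"
  proof (cases "C = {}")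
    case True
    with C show ?thesis by (intro exI[of _ ps]) auto
  next
    case False
    with C show ?thesis by (intro exI[of _ "[]"]) auto
  qed
qed

lemma rising_appendD:
  assumes "rising C (ps @ qs)"
  shows "rising C ps" "rising C qs"
  using assms by (auto simp: rising_def sorted_append)

text \<open>Every chain restricts to a chain in each part of a direct sum, and the increasing
  subsequences left over in the two parts concatenate.\<close>

lemma residual_append_le:
  assumes "residual f s" "residual g t" and le: "\<forall>y\<in>set s. \<forall>z\<in>set t. y \<le> z"
  shows "residual (\<lambda>k. f k + g k) (s @ t)"
  unfolding residual_def
proof (intro allI impI)
  fix C :: "nat set" and ps :: "(nat \<times> nat) list"
  assume C: "finite C" "rising C ps" "map fst ps = s @ t"
  then obtain p q where pq: "ps = p @ q" "map fst p = s" "map fst q = t"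
    by (auto simp: map_eq_append_conv)
  obtain u where u: "subseq u p" "sorted (map fst u)" "snd ` set u \<inter> C = {}" "f (card C) \<le> length u"
    using residualE[OF assms(1) C(1) _ pq(2)] rising_appendD C(2) pq(1) by metis
  obtain v where v: "subseq v q" "sorted (map fst v)" "snd ` set v \<inter> C = {}" "g (card C) \<le> length v"
    using residualE[OF assms(2) C(1) _ pq(3)] rising_appendD C(2) pq(1) by metis
  have "set (map fst u) \<subseteq> set s" "set (map fst v) \<subseteq> set t"
    unfolding pq(2,3)[symmetric] set_map using set_subseq[OF u(1)] set_subseq[OF v(1)]
    by (simp_all add: image_mono)
  with u v le have "sorted (map fst (u @ v))" by (fastforce simp: sorted_append)
  with u v pq show "\<exists>ts. subseq ts ps \<and> sorted (map fst ts) \<and> snd ` set ts \<inter> C = {} \<and>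
      f (card C) + g (card C) \<le> length ts"
    by (intro exI[of _ "u @ v"]) (auto intro: list_emb_append_mono)
qed

text \<open>The chains of a skew sum divide into \<open>a\<close> for the first part and
  \<open>b\<close> for the second; the longer of the two leftovers is used.\<close>

lemma residual_append_greater:
  assumes "residual f s" "residual g t" and gr: "\<forall>y\<in>set s. \<forall>z\<in>set t. y > z"
    and h: "\<And>a b. h (a + b) \<le> max (f a) (g b)"
  shows "residual h (s @ t)"
  unfolding residual_def
proof (intro allI impI)
  fix C :: "nat set" and ps :: "(nat \<times> nat) list"
  assume C: "finite C" "rising C ps" "map fst ps = s @ t"
  then obtain p q where pq: "ps = p @ q" "map fst p = s" "map fst q = t"
    by (auto simp: map_eq_append_conv)
  \<comment> \<open>No colour of \<open>C\<close> occurs in both parts, as it would descend from the first to the second.\<close>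
  define A where "A = C \<inter> snd ` set p"
  have disj: "snd ` set q \<inter> A = {}"
  proof (rule ccontr)
    assume "snd ` set q \<inter> A \<noteq> {}"
    then obtain c x y where c: "c \<in> C" "(x, c) \<in> set p" "(y, c) \<in> set q"
      by (force simp: A_def)
    then have "x \<le> y"
      using C(2) pq(1) by (auto simp: rising_def sorted_append in_set_col)
    moreover have "y < x"
      using c gr pq by force
    ultimately show False by simp
  qed
  have "rising A p" "rising (C - A) q"
    using C(2) pq(1) by (auto simp: A_def rising_def sorted_append)
  obtain u where u: "subseq u p" "sorted (map fst u)" "snd ` set u \<inter> A = {}" "f (card A) \<le> length u"
    using residualE[OF assms(1) _ \<open>rising A p\<close> pq(2)] C(1) unfolding A_def by blast
  obtain v where v: "subseq v q" "sorted (map fst v)" "snd ` set v \<inter> (C - A) = {}"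
      "g (card (C - A)) \<le> length v"
    using residualE[OF assms(2) _ \<open>rising (C - A) q\<close> pq(3)] C(1) by blast
  have "snd ` set u \<subseteq> snd ` set p" "snd ` set v \<subseteq> snd ` set q"
    by (intro image_mono set_subseq u v)+
  \<comment> \<open>All colours of \<open>C\<close> occurring in \<open>p\<close> belong to
    \<open>A\<close>, and none of \<open>A\<close> occurs in \<open>q\<close>; hence avoiding
    \<open>A\<close> in \<open>p\<close>, or \<open>C - A\<close> in \<open>q\<close>, amounts to
    avoiding \<open>C\<close>.\<close>
  moreover have "U \<inter> C = {}" if "U \<inter> A = {}" "U \<subseteq> snd ` set p" for U
    using that unfolding A_def by (metis inf.absorb_iff1 inf_assoc inf_commute)
  moreover have "V \<inter> C = {}" if "V \<inter> (C - A) = {}" "V \<subseteq> Q" "Q \<inter> A = {}" for V Q :: "nat set"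
    using that by blast
  ultimately have "snd ` set u \<inter> C = {}" "snd ` set v \<inter> C = {}"
    using u(3) v(3) disj by metis+
  moreover have "card C = card A + card (C - A)"
    using C(1) by (subst card_Diff_subset) (auto simp: A_def card_mono)
  then have "h (card C) \<le> length u \<or> h (card C) \<le> length v"
    using h[of "card A" "card (C - A)"] u(4) v(4) by (auto simp: le_max_iff_disj)
  moreover have "subseq u ps" "subseq v ps"
    using u(1) v(1) pq(1) by (auto intro: subseq_rev_drop_many)
  ultimately show "\<exists>ts. subseq ts ps \<and> sorted (map fst ts) \<and> snd ` set ts \<inter> C = {} \<and>
      h (card C) \<le> length ts"
    using u(2) v(2) by blast
qed

text \<open>Induction along direct and skew sums. The lower bound on the total of \<mu> is what
  later makes \<mu> equal to the shape.\<close>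

lemma residual_exists:
  assumes "distinct s" "avoids (<) s" "avoids (>) s"
  shows "\<exists>\<mu>. antimono \<mu> \<and> length s \<le> (\<Sum>k<length s. \<mu> k) \<and> residual \<mu> s"
  using assms
proof (induction s rule: length_induct)
  case (1 s)
  consider "s = []" | x where "s = [x]" | "2 \<le> length s"
    by (cases s; cases "tl s") auto
  then show ?case
  proof cases
    case 1
    then show ?thesis using residual_Nil by (auto simp: antimono_def)
  next
    case 2
    then show ?thesis
      using residual_singleton[of x]
      by (intro exI[of _ "\<lambda>k. if k = 0 then 1 else 0"]) (auto simp: antimono_def)
  next
    case 3
    with 1 have "splits (<) s \<or> splits (>) s" by (intro avoids_splits) auto
    then obtain y z where s: "s = y @ z" "y \<noteq> []" "z \<noteq> []"
      and split: "(\<forall>a\<in>set y. \<forall>b\<in>set z. a < b) \<or> (\<forall>a\<in>set y. \<forall>b\<in>set z. a > b)"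
      unfolding splits_def by blast
    have "subseq y s" "subseq z s" by (auto simp: s)
    then have "avoids (<) y" "avoids (>) y" "avoids (<) z" "avoids (>) z"
      using 1(3,4) avoids_subseq by blast+
    moreover have "distinct y" "distinct z" "length y < length s" "length z < length s"
      using 1(2) s by auto
    ultimately obtain f g where
      f: "antimono f" "length y \<le> (\<Sum>k<length y. f k)" "residual f y" and
      g: "antimono g" "length z \<le> (\<Sum>k<length z. g k)" "residual g z"
      using 1(1) by metis
    from split show ?thesis
    proof
      assume "\<forall>a\<in>set y. \<forall>b\<in>set z. a < b"
      then have "residual (\<lambda>k. f k + g k) s"
        unfolding s(1) using f g by (intro residual_append_le) (auto simp: less_imp_le)
      moreover have "(\<Sum>k<length y. f k) \<le> (\<Sum>k<length s. f k)"
        "(\<Sum>k<length z. g k) \<le> (\<Sum>k<length s. g k)"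
        by (intro sum_mono2; simp add: s)+
      then have "length s \<le> (\<Sum>k<length s. f k + g k)"
        using f(2) g(2) s(1) by (simp add: sum.distrib)
      moreover have "antimono (\<lambda>k. f k + g k)"
        using f(1) g(1) by (simp add: antimono_def add_mono)
      ultimately show ?thesis by blast
    next
      assume gr: "\<forall>a\<in>set y. \<forall>b\<in>set z. a > b"
      \<comment> \<open>The largest function that \<open>residual_append_greater\<close> permits; as
        the minimum is attained, \<open>sum_merge_le\<close> applies as well.\<close>
      define h where "h k = Min ((\<lambda>a. max (f a) (g (k - a))) ` {..k})" for k
      have h_le: "h (a + b) \<le> max (f a) (g b)" for a b
        unfolding h_def by (intro Min_le) (auto intro!: image_eqI[of _ _ a])
      have h_ex: "\<exists>a b. a + b = k \<and> h k = max (f a) (g b)" for k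
      proof -
        have "h k \<in> (\<lambda>a. max (f a) (g (k - a))) ` {..k}"
          unfolding h_def by (intro Min_in) auto
        then show ?thesis by (force intro: le_add_diff_inverse)
      qed
      have "residual h s"
        unfolding s(1) by (rule residual_append_greater[OF f(3) g(3) gr h_le])
      moreover have "(\<Sum>k<length y. f k) + (\<Sum>k<length z. g k) \<le> (\<Sum>k<length y + length z. h k)"
        using h_ex by (intro sum_merge_le f(1) g(1)) (metis order_refl)
      then have "length s \<le> (\<Sum>k<length s. h k)"
        using f(2) g(2) by (simp add: s(1))
      moreover have "h (Suc k) \<le> h k" for k
      proof -
        obtain a b where ab: "a + b = k" "h k = max (f a) (g b)" using h_ex by blast
        have "h (Suc k) \<le> max (f (Suc a)) (g b)" using h_le[of "Suc a" b] ab by simp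
        also have "\<dots> \<le> max (f a) (g b)" using f(1) by (auto simp: antimono_def intro: max.coboundedI1)
        finally show ?thesis using ab by simp
      qed
      then have "antimono h" by (simp add: antimono_iff_le_Suc)
      ultimately show ?thesis by blast
    qed
  qed
qed

section \<open>Transport along order-preserving relabellings\<close>

lemma col_map_apfst: "col c (map (apfst f) ps) = map f (col c ps)"
  by (induction ps) auto

lemma set_col_subset: "set (col c ps) \<subseteq> set (map fst ps)"
  by (auto simp: col_def)

text \<open>A strictly increasing \<open>f\<close> preserves and reflects the order of letters, so
  colourings pull back to \<open>s\<close> and leftover chains push forward.\<close>

lemma residual_map:
  assumes "residual \<mu> s" and mono: "\<And>x y. x \<in> set s \<Longrightarrow> y \<in> set s \<Longrightarrow> x < y \<Longrightarrow> f x < f y"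
  shows "residual \<mu> (map f s)"
  unfolding residual_def
proof (intro allI impI)
  fix C :: "nat set" and ps :: "(nat \<times> nat) list"
  assume C: "finite C" "rising C ps" "map fst ps = map f s"
  define qs where "qs = zip s (map snd ps)"
  have len: "length ps = length s" using C(3) by (metis length_map)
  have qs: "map fst qs = s" by (simp add: qs_def len)
  have ps: "ps = map (apfst f) qs"
    using C(3) len by (intro nth_equalityI) (auto simp: qs_def prod_eq_iff list_eq_iff_nth_eq)
  have "sorted (col c qs)" if "c \<in> C" for c
  proof -
    have "sorted_wrt (\<lambda>x y. f x \<le> f y) (col c qs)"
      using C(2) that by (simp add: rising_def ps col_map_apfst sorted_map)
    moreover have "x \<le> y" if "x \<in> set (col c qs)" "y \<in> set (col c qs)" "f x \<le> f y" for x y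
      using that mono[of y x] set_col_subset[of c qs] qs by (metis leD linorder_le_less_linear subsetD)
    ultimately show ?thesis by (rule sorted_wrt_mono_rel[rotated])
  qed
  then have "rising C qs" by (simp add: rising_def)
  then obtain ts where ts: "subseq ts qs" "sorted (map fst ts)" "snd ` set ts \<inter> C = {}"
      "\<mu> (card C) \<le> length ts"
    using residualE[OF assms(1) C(1) _ qs] by blast
  have "subseq (map (apfst f) ts) ps"
    using ts(1) by (simp add: ps subseq_map)
  moreover have "f x \<le> f y" if "x \<in> set (map fst ts)" "y \<in> set (map fst ts)" "x \<le> y" for x y
  proof -
    have "set (map fst ts) \<subseteq> set s"
      unfolding qs[symmetric] set_map by (rule image_mono[OF set_subseq[OF ts(1)]])
    with that mono[of x y] show ?thesis by (cases "x = y") (auto simp: le_less subset_iff)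
  qed
  then have "sorted_wrt (\<lambda>x y. f x \<le> f y) (map fst ts)"
    using ts(2) by (rule sorted_wrt_mono_rel)
  then have "sorted (map fst (map (apfst f) ts))"
    by (simp add: sorted_wrt_map)
  ultimately show "\<exists>ts. subseq ts ps \<and> sorted (map fst ts) \<and> snd ` set ts \<inter> C = {} \<and>
      \<mu> (card C) \<le> length ts"
    using ts(3,4) by (intro exI[of _ "map (apfst f) ts"]) (auto simp: image_image)
qed

lemma sorted_wrt_subseq: "subseq xs ys \<Longrightarrow> sorted_wrt R ys \<Longrightarrow> sorted_wrt R xs"
proof (induction rule: list_emb.induct)
  case (list_emb_Cons2 x y xs ys)
  then show ?case using set_subseq[of xs ys] by auto
qed auto

lemma rising_subseq:
  assumes "subseq qs ps" "rising C ps"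
  shows "rising C qs"
proof -
  have "subseq (col c qs) (col c ps)" for c
    unfolding col_def using assms(1) by (intro subseq_map) (simp add: subseq_filter)
  with assms(2) show ?thesis
    by (auto simp: rising_def intro: sorted_wrt_subseq)
qed

section \<open>From leftover chains to parts of the shape\<close>

lemma covered_sum: "finite C \<Longrightarrow> covered C ps = (\<Sum>c\<in>C. length (col c ps))"
proof (induction ps)
  case (Cons p ps)
  obtain x d where p: "p = (x, d)" by (cases p)
  have "(\<Sum>c\<in>C. length (col c (p # ps))) = (\<Sum>c\<in>C. (if d = c then 1 else 0) + length (col c ps))"
    by (intro sum.cong) (auto simp: p)
  with Cons show ?case by (simp add: p sum.distrib)
qed simp

text \<open>Adds \<open>ts\<close> as a new chain of colour \<open>k\<close>. Other entries of
  colour at least \<open>k\<close> are moved to \<open>Suc k\<close>, so that colour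
  \<open>k\<close> holds exactly \<open>ts\<close>.\<close>

lemma recolour_subseq:
  fixes k :: nat
  assumes "subseq ts ps" "\<forall>p\<in>set ts. k \<le> snd p"
  shows "\<exists>qs. map fst qs = map fst ps \<and> (\<forall>c<k. col c qs = col c ps) \<and> col k qs = map fst ts"
  using assms
proof (induction rule: list_emb.induct)
  case (list_emb_Nil ps)
  show ?case
    by (intro exI[of _ "map (apsnd (\<lambda>c. if c < k then c else Suc k)) ps"], induction ps) auto
next
  case (list_emb_Cons ts ps p)
  then obtain qs where "map fst qs = map fst ps" "\<forall>c<k. col c qs = col c ps" "col k qs = map fst ts"
    by blast
  then show ?case
    by (intro exI[of _ "(fst p, if snd p < k then snd p else Suc k) # qs"]) (cases p, auto)
next
  case (list_emb_Cons2 t p ts ps)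
  then obtain qs where "map fst qs = map fst ps" "\<forall>c<k. col c qs = col c ps" "col k qs = map fst ts"
    by auto
  with list_emb_Cons2 show ?case
    by (intro exI[of _ "(fst p, k) # qs"]) (cases p, auto)
qed

text \<open>Both halves of Greene's theorem meet: \<open>k\<close> chains attaining the first
  \<open>k\<close> parts gain one more chain, and the upper bound for \<open>Suc k\<close> chains
  leaves its length to part \<open>k\<close>.\<close>

lemma residual_le_sh:
  assumes "residual \<mu> v" "subseq v w"
  shows "\<mu> k \<le> sh w k"
proof -
  obtain ps where ps: "map fst ps = w" "rising {..<k} ps" "covered {..<k} ps = (\<Sum>i<k. sh w i)"
    using greene_attained by blast
  \<comment> \<open>Choosing \<open>v\<close> by positions lets it inherit the colours of
    \<open>w\<close>.\<close>
  obtain N where "v = nths w N" using assms(2) by (auto simp: subseq_conv_nths)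
  with ps(1) have v: "map fst (nths ps N) = v" by (metis nths_map)
  have sub: "subseq (nths ps N) ps" by (auto simp: subseq_conv_nths)
  obtain ts where ts: "subseq ts (nths ps N)" "sorted (map fst ts)" "snd ` set ts \<inter> {..<k} = {}"
      "\<mu> k \<le> length ts"
    using residualE[OF assms(1) _ rising_subseq[OF sub ps(2)] v] by (metis card_lessThan finite_lessThan)
  have "\<forall>p\<in>set ts. k \<le> snd p" using ts(3) by force
  then obtain qs where qs: "map fst qs = map fst ps" "\<forall>c<k. col c qs = col c ps" "col k qs = map fst ts"
    using recolour_subseq subseq_order.order_trans[OF ts(1) sub] by metis
  have "rising {..<Suc k} qs"
    using ps(2) qs ts(2) by (auto simp: rising_def less_Suc_eq)
  then have "covered {..<Suc k} qs \<le> (\<Sum>i<Suc k. sh w i)"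
    using greene_upper[of "{..<Suc k}" qs "Suc k"] qs(1) ps(1) by simp
  moreover have "covered {..<Suc k} qs = covered {..<k} ps + length ts"
    using qs(2,3) by (simp add: covered_sum)
  ultimately show ?thesis using ps(3) ts(4) by simp
qed

section \<open>Pattern occurrences as relabelled subsequences\<close>

lemma subseq_map_nth:
  assumes "strict_mono_on {..<m} i" "\<forall>j<m. i j < N" "N \<le> length w"
  shows "subseq (map (\<lambda>j. w ! i j) [0..<m]) (take N w)"
  using assms
proof (induction m arbitrary: N)
  case (Suc m)
  \<comment> \<open>The first \<open>m\<close> chosen positions lie before \<open>i m\<close>, so
    the induction hypothesis is used for the prefix of that length.\<close>
  then have "subseq (map (\<lambda>j. w ! i j) [0..<m]) (take (i m) w)"
    by (intro Suc.IH) (auto simp: strict_mono_on_def less_imp_le order.strict_trans2)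
  then have "subseq (map (\<lambda>j. w ! i j) [0..<Suc m]) (take (Suc (i m)) w)"
    using Suc.prems by (auto simp: take_Suc_conv_app_nth)
  moreover have "subseq (take (Suc (i m)) w) (take N w)"
    using Suc.prems(2) take_is_prefix[of "Suc (i m)" "take N w"]
    by (intro prefix_imp_subseq) (auto simp: min_def split: if_splits)
  ultimately show ?case by (rule subseq_order.order_trans)
qed simp

text \<open>Since the entries of \<open>s\<close> are distinct, a letter determines its position,
  and the matching of positions becomes a map \<open>f\<close> on letters.\<close>

lemma contains_patternE:
  assumes "contains_pattern w s" "distinct s"
  obtains f where "subseq (map f s) w" "\<And>x y. x \<in> set s \<Longrightarrow> y \<in> set s \<Longrightarrow> x < y \<Longrightarrow> f x < f y"
proof -
  obtain i where i: "strict_mono_on {..<length s} i" "\<forall>j<length s. i j < length w"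
    "\<And>j k. j < length s \<Longrightarrow> k < length s \<Longrightarrow> w ! i j < w ! i k \<longleftrightarrow> s ! j < s ! k"
    using assms(1) unfolding contains_pattern_def by blast
  define pos where "pos x = (THE j. j < length s \<and> s ! j = x)" for x
  have pos: "pos (s ! j) = j" if "j < length s" for j
    unfolding pos_def using that assms(2) by (auto simp: nth_eq_iff_index_eq)
  show thesis
  proof
    have "map (\<lambda>x. w ! i (pos x)) s = map (\<lambda>j. w ! i j) [0..<length s]"
      by (intro nth_equalityI) (simp_all add: pos)
    then show "subseq (map (\<lambda>x. w ! i (pos x)) s) w"
      using subseq_map_nth[OF i(1,2), of w] by simp
    show "w ! i (pos x) < w ! i (pos y)" if "x \<in> set s" "y \<in> set s" "x < y" for x y
      using that i(3) pos by (metis in_set_conv_nth)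
  qed
qed

section \<open>Comparison of the two shapes\<close>

lemma sum_sh_le_length: "(\<Sum>i<k. sh w i) \<le> length w"
  using greene_attained[of w k] by (metis covered_def length_filter_le length_map)

theorem theorem1:
  fixes n m :: nat and w \<sigma> :: "nat list"
  assumes "set w \<subseteq> {1..n}"
    and "\<sigma> \<in> permutations_of_set {1..m}"
    and "separable \<sigma>"
    and "contains_pattern w \<sigma>"
  shows "\<forall>i. sh \<sigma> i \<le> sh w i"
proof
  fix i
  have "distinct \<sigma>" using assms(2) by (rule permutations_of_setD)
  then obtain \<mu> where sum: "length \<sigma> \<le> (\<Sum>k<length \<sigma>. \<mu> k)" and \<mu>: "residual \<mu> \<sigma>"
    using residual_exists separable_avoids[OF assms(3)] by blast
  obtain f where "subseq (map f \<sigma>) w"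
    "\<And>x y. x \<in> set \<sigma> \<Longrightarrow> y \<in> set \<sigma> \<Longrightarrow> x < y \<Longrightarrow> f x < f y"
    using contains_patternE[OF assms(4) \<open>distinct \<sigma>\<close>] by blast
  then have le_w: "\<mu> k \<le> sh w k" for k
    using residual_le_sh[OF residual_map[OF \<mu>]] by blast
  have le: "\<mu> k \<le> sh \<sigma> k" for k
    using residual_le_sh[OF \<mu>] by blast
  \<comment> \<open>Large enough to include index \<open>i\<close> and the whole range over which
    \<mu> is known to sum to at least the length of \<sigma>.\<close>
  define N where "N = max (length \<sigma>) (Suc i)"
  have "(\<Sum>k<N. sh \<sigma> k) \<le> length \<sigma>" by (rule sum_sh_le_length)
  also have "\<dots> \<le> (\<Sum>k<length \<sigma>. \<mu> k)" by (rule sum)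
  also have "\<dots> \<le> (\<Sum>k<N. \<mu> k)" by (intro sum_mono2) (auto simp: N_def)
  finally have "(\<Sum>k<N. \<mu> k) = (\<Sum>k<N. sh \<sigma> k)"
    using sum_mono[of "{..<N}" \<mu> "sh \<sigma>"] le by (simp add: le_antisym)
  \<comment> \<open>Termwise inequality together with equal sums forces equality in every
    term.\<close>
  then have "\<mu> i = sh \<sigma> i"
    using sum_mono_inv[of \<mu> "{..<N}" "sh \<sigma>" i] le by (simp add: N_def)
  with le_w show "sh \<sigma> i \<le> sh w i" by metis
qed

end
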